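(* Let $\mathcal{S} = (\mathcal{S}_R, \Delta_{\mathcal{T}}, \mathcal{C})$ be a GCA system with $n$-redundancies satisfying the deterministic assumption, and let $\mathcal{S}_{sync} = (\mathcal{S}_R, \Delta_{\mathcal{T}}, \mathcal{C})$ be the GCA system (over the same $\mathcal{S}_R$, $\Delta_{\mathcal{T}}$, $\mathcal{C}$) in which all machines execute synchronously in actions, i.e., in each period, if $T_{i,\sigma_k}$ denotes the clock reading of $\mathcal{C}$ at which the $k$-th action of $\overline{\sigma}$ is activated on machine $i$, then $T_{i,\sigma_k}=T_{j,\sigma_k}$ for all $i,j \in \{1,\ldots,n\}$ (and every $k$). Then for every verification condition $\varphi$ satisfying the two constraints below, $$\mathcal{S} \models \varphi \iff \mathcal{S}_{sync} \models \varphi .$$ (1) $\varphi$ is a formula of propositional linear temporal logic (PLTL) that does not use the next operator $\mathbf{X}$. (2) There exists $i\in\{1,\ldots,n\}$ such that every propositional variable $p$ used in $\varphi$ is a predicate over $V_i\cup\Delta_{next_i}$, i.e., $p$ has the form $exp = c$, where $exp ::= exp + exp \mid exp * exp \mid exp / exp \mid v_a \mid -(v_a) \mid const$, with $v_a \in V_i\cup \Delta_{next_i}$, and $c$, $const$ constants (so $\varphi$ is a property local to machine $i$ and does not refer to message queues).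
   Context: **Machines.** Fix $n\ge 1$; indices of machines lie in $\{1,\dots,n\}$ and $\oplus$ is addition modulo $n$ on these indices. The pattern of the machine with coefficient $(x,n)$ is $\mathcal{A}_{x,n} = (V \cup V_{env_x}, \overline{\sigma}, Q_x)$, where $V$ is a set of arrays of length $n$; $V_{env_x}$ is a set of environment variables; $Q_x$ is a message queue; and $\overline{\sigma} = \sigma_1;\sigma_2;\ldots;\sigma_k$ is a fixed sequence of atomic actions (the same for all machines up to instantiating the index $x$), each of one of the forms $\mathtt{send}(a[x])$, or $a[x]\leftarrow e$, or $\mathtt{receive}(a[x\oplus 1],\ldots,a[x\oplus n])$. Here $a\in V$, $a[x]$ is the $x$-th element of $a$, and $e$ is an operation over the variables in $V_{env_x}$ and the $a[x\oplus i]$, $i=1,\ldots,n$, $a\in V$. Each machine holds its own local copy of the arrays in $V$; machine $x$'s entry $a[x]$ is its own value, its other entries of $a$ are stored copies of values sent by other machines. $V_i$ denotes the local copy of $V$ in machine $i$. **Redundant system.** The redundant system $\mathcal{S}_R$ with $n$-redundancy is the collection of the machines $\mathcal{A}_{1,n},\ldots,\mathcal{A}_{n,n}$. Its configuration is $((v_1,q_1,\Delta_{next_1}),\ldots,(v_n,q_n,\Delta_{next_n}))$, where $v_i$ gives the current values of $V$ in machine $i$, $q_i$ is the current content of $Q_i$, and $\Delta_{next_i}$, which is an atomic action of $\overline{\sigma}$ or $\mathtt{null}$, is the next action machine $i$ takes. Executing an action $\sigma_j$ on machine $i$ (when $\Delta_{next_i}=\sigma_j$) changes $\Delta_{next_i}$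 to $\sigma_{j+1}$ if $j<k$ and to $\mathtt{null}$ if $j=k$, and in addition: - $a[i]\leftarrow e$ updates $a[i]$ in machine $i$ to the value of $e$; - $\mathtt{send}(a[i])$ appends, for every machine $m\ne i$, the message $(a[i],\hat a)$ to the queue of $m$, where $\hat a$ is the current value of $a[i]$ in machine $i$; - $\mathtt{receive}(a[i\oplus1],\ldots,a[i\oplus n])$ does the following for each $i'\neq i$: if $(a[i'],a_1);\ldots;(a[i'],a_{last})$ is the subsequence of all messages in $q_i$ with variable $a[i']$, these messages are removed from $Q_i$ and the local copy of $a[i']$ in machine $i$ is updated to $a_{last}$; if there is no such message, $a[i']$ is not updated. **GCA system.** A global-cycle-accurate (GCA) system with $n$-redundancies over $\mathcal{S}_R$ is $\mathcal{S}=(\mathcal{S}_R,\Delta_{\mathcal{T}},\mathcal{C})$, where $\Delta_{\mathcal{T}}$ is a global periodic jump with period $\mathcal{T}$ and $\mathcal{C}$ is a global clock. Its configuration changes by: actions of $\mathcal{S}_R$ (executed by the machines at arbitrary times, subject to the constraint below); the jump $\Delta_{\mathcal{T}}$, which for all $x=1,\ldots,n$ reads the values $a[x]$ ($a\in V$), updates $V_{env_x}$, and resets $\Delta_{next_x}$ to $\sigma_1$; and the advance of the clock $\mathcal{C}$. Constraint: starting from $t=0$, $\Delta_{\mathcal{T}}$ is always activated with period $\mathcal{T}$, and whenever it is activated, $\Delta_{next_1},\ldots,\Delta_{next_n}$ are all $\mathtt{null}$ (i.e., in every period of length $\mathcal{T}$ each machine completes the action sequence $\overline{\sigma}$). **Deterministic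 assumption.** Let $\sigma_\beta=\mathtt{receive}(a[x\oplus1],\ldots,a[x\oplus n])$ be a receive action in $\overline\sigma$, and let $\sigma_\alpha=\mathtt{send}(a[x])$ and $\sigma_\gamma=\mathtt{send}(a[x])$ be its predecessor and successor send operations (for the same array $a$) in $\overline\sigma$, $\alpha<\beta<\gamma$. Let $\tau_{Send,\alpha,i}$ be the clock reading from $\mathcal C$ at which $\sigma_\alpha$ happens on machine $i$ (set to $-\infty$ if $\sigma_\alpha$ does not exist), $\tau_{Receive,\beta,j}$ the clock reading at which $\sigma_\beta$ happens on machine $j$, and $\tau_{Send,\gamma,k}$ the clock reading at which $\sigma_\gamma$ happens on machine $k$ (set to $\infty$ if $\sigma_\gamma$ does not exist). The GCA system satisfies the deterministic assumption if, in each period and for all such receive actions and all machines $i,j,k$, $\tau_{Send,\alpha,i}<\tau_{Receive,\beta,j}<\tau_{Send,\gamma,k}$. **Satisfaction.** $\mathcal{S}\models\varphi$ means that every execution trace of $\mathcal{S}$ satisfies $\varphi$.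
   Formalization: Synchronous execution additionally requires that successive actions of the sequence have strictly increasing clock readings; otherwise, e.g. for send(a);receive(a) all at one reading, a machine could receive before another sends and the equivalence fails. *)

theory Defs
  imports Complex_Main "HOL-Library.Extended_Real"
begin

section \<open>Machines and their actions\<close>

text \<open>
  Arrays are named by the type \<open>'a\<close>, environment variables by \<open>'e\<close>, and both hold values of
  type \<open>'v\<close>.  Machines and array positions are numbered \<open>1, \<dots>, n\<close>, with cyclic addition.
\<close>

definition cyc_add :: "nat \<Rightarrow> nat \<Rightarrow> nat \<Rightarrow> nat" where
  "cyc_add n x d = (x + d - 1) mod n + 1"

text \<open>
  Actions are written relative to the index \<open>x\<close> of the machine that executes them, so that one
  program serves all machines: in \<open>Assign a e\<close>, i.e. \<open>a[x] := e\<close>, the operation \<open>e\<close> is given the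
  valuation of the environment variables of \<open>x\<close> and the function sending \<open>b\<close> and an offset \<open>d\<close>
  to the stored value of \<open>b[x \<oplus> d]\<close>.
\<close>

datatype ('a, 'e, 'v) action =
    Send 'a
  | Assign 'a "('e \<Rightarrow> 'v) \<Rightarrow> ('a \<Rightarrow> nat \<Rightarrow> 'v) \<Rightarrow> 'v"
  | Receive 'a

text \<open>
  A message is a pair of a variable \<open>a[i]\<close>, written \<open>(a, i)\<close>, and a value.  Since an action may occur
  repeatedly in the program, \<open>nxt\<close> holds the position (from 0) of the next action rather than the
  action itself; \<open>None\<close> is null.
\<close>

record ('a, 'e, 'v) mstate =
  vars :: "'a \<Rightarrow> nat \<Rightarrow> 'v"
  env :: "'e \<Rightarrow> 'v"
  queue :: "(('a \<times> nat) \<times> 'v) list"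
  nxt :: "nat option"

type_synonym ('a, 'e, 'v) config = "nat \<Rightarrow> ('a, 'e, 'v) mstate"

record ('a, 'e, 'v) redundant_system =
  size_of :: nat
  program :: "('a, 'e, 'v) action list"
  initial :: "('a, 'e, 'v) config set"

definition machines :: "('a, 'e, 'v) redundant_system \<Rightarrow> nat set" where
  "machines R = {1..size_of R}"

definition msgs :: "('a \<times> nat) \<Rightarrow> (('a \<times> nat) \<times> 'v) list \<Rightarrow> 'v list" where
  "msgs x q = map snd (filter (\<lambda>msg. fst msg = x) q)"

fun perform ::
  "('a, 'e, 'v) redundant_system \<Rightarrow> nat \<Rightarrow> ('a, 'e, 'v) action \<Rightarrow>
   ('a, 'e, 'v) config \<Rightarrow> ('a, 'e, 'v) config" where
  "perform R i (Assign a e) c =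
     c(i := c i\<lparr>vars := (vars (c i))(a := (vars (c i) a)(i :=
        e (env (c i)) (\<lambda>b d. vars (c i) b (cyc_add (size_of R) i d))))\<rparr>)"
| "perform R i (Send a) c =
     (\<lambda>m. if m \<in> machines R - {i}
          then c m\<lparr>queue := queue (c m) @ [((a, i), vars (c i) a i)]\<rparr> else c m)"
| "perform R i (Receive a) c =
     c(i := c i\<lparr>
       vars := (vars (c i))(a := (\<lambda>i'.
         if i' \<in> machines R - {i} \<and> msgs (a, i') (queue (c i)) \<noteq> []
         then last (msgs (a, i') (queue (c i))) else vars (c i) a i')),
       queue := filter (\<lambda>msg. fst msg \<notin> {a} \<times> (machines R - {i})) (queue (c i))\<rparr>)"

definition advance ::
  "('a, 'e, 'v) redundant_system \<Rightarrow> nat \<Rightarrow> nat \<Rightarrow> ('a, 'e, 'v) config \<Rightarrow> ('a, 'e, 'v) config" where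
  "advance R i j c =
     c(i := c i\<lparr>nxt := if Suc j < length (program R) then Some (Suc j) else None\<rparr>)"


section \<open>Globally cycle-accurate systems\<close>

text \<open>
  A timing gives the clock reading \<open>\<theta> m i j\<close> at which, in period \<open>m\<close>, the \<open>j\<close>-th action is executed
  by machine \<open>i\<close>.  The triple of redundant system, jump and clock does not by itself say when the
  machines act; a system carries the set of timings it may exhibit.  Properties such as the
  deterministic assumption, which would fail if all timings were always possible, are conditions
  on this set.

  The first argument of \<open>env_step\<close> gives the value of \<open>a[x]\<close> in machine \<open>x\<close>, the other two are the
  valuations of the environment variables of all machines before and after the jump.  The clock is
  real-valued and starts at 0.
\<close>

type_synonym timing = "nat \<Rightarrow> nat \<Rightarrow> nat \<Rightarrow> real"

record ('a, 'e, 'v) gca =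
  redundant :: "('a, 'e, 'v) redundant_system"
  env_step :: "(nat \<Rightarrow> 'a \<Rightarrow> 'v) \<Rightarrow> (nat \<Rightarrow> 'e \<Rightarrow> 'v) \<Rightarrow> (nat \<Rightarrow> 'e \<Rightarrow> 'v) \<Rightarrow> bool"
  period :: real
  timings :: "timing set"

definition admissible_timing :: "('a, 'e, 'v) redundant_system \<Rightarrow> real \<Rightarrow> timing \<Rightarrow> bool" where
  "admissible_timing R T \<theta> \<longleftrightarrow>
     (\<forall>m. \<forall>i\<in>machines R. \<forall>j<length (program R).
        real m * T \<le> \<theta> m i j \<and> \<theta> m i j \<le> real (Suc m) * T \<and>
        (\<forall>j'<j. \<theta> m i j' \<le> \<theta> m i j))"

definition gca_system :: "('a, 'e, 'v) gca \<Rightarrow> bool" where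
  "gca_system S \<longleftrightarrow>
     1 \<le> size_of (redundant S) \<and> program (redundant S) \<noteq> [] \<and> 0 < period S \<and>
     (\<forall>c\<in>initial (redundant S). \<forall>i\<in>machines (redundant S). nxt (c i) = None) \<and>
     timings S \<noteq> {} \<and>
     (\<forall>\<theta>\<in>timings S. admissible_timing (redundant S) (period S) \<theta>)"

datatype event = Act nat nat | Jump | Tick

fun step ::
  "('a, 'e, 'v) gca \<Rightarrow> event \<Rightarrow> ('a, 'e, 'v) config \<times> real \<Rightarrow> ('a, 'e, 'v) config \<times> real \<Rightarrow> bool"
where
  "step S (Act i j) (c, t) (c', t') \<longleftrightarrow>
     i \<in> machines (redundant S) \<and> nxt (c i) = Some j \<and> j < length (program (redundant S)) \<and>
     c' = advance (redundant S) i j (perform (redundant S) i (program (redundant S) ! j) c) \<and>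
     t' = t"
| "step S Jump (c, t) (c', t') \<longleftrightarrow>
     (\<forall>i\<in>machines (redundant S). nxt (c i) = None) \<and>
     (\<exists>env'. env_step S (\<lambda>x a. vars (c x) a x) (\<lambda>x. env (c x)) env' \<and>
        c' = (\<lambda>x. if x \<in> machines (redundant S)
                  then c x\<lparr>env := env' x, nxt := Some 0\<rparr> else c x)) \<and>
     t' = t"
| "step S Tick (c, t) (c', t') \<longleftrightarrow> c' = c \<and> t < t'"

record ('a, 'e, 'v) run =
  cfg :: "nat \<Rightarrow> ('a, 'e, 'v) config"
  clk :: "nat \<Rightarrow> real"
  evt :: "nat \<Rightarrow> event"

text \<open>Periods are numbered from 0, and period \<open>m\<close> begins with the jump at clock reading \<open>m * T\<close>.\<close>

definition period_no :: "('a, 'e, 'v) run \<Rightarrow> nat \<Rightarrow> nat" where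
  "period_no r l = card {l'. l' < l \<and> evt r l' = Jump} - 1"

definition execution :: "('a, 'e, 'v) gca \<Rightarrow> ('a, 'e, 'v) run \<Rightarrow> bool" where
  "execution S r \<longleftrightarrow>
     cfg r 0 \<in> initial (redundant S) \<and> clk r 0 = 0 \<and>
     (\<forall>l. step S (evt r l) (cfg r l, clk r l) (cfg r (Suc l), clk r (Suc l))) \<and>
     (\<forall>l. evt r l = Jump \<longrightarrow> (\<exists>m::nat. clk r l = real m * period S)) \<and>
     (\<forall>m::nat. \<exists>!l. evt r l = Jump \<and> clk r l = real m * period S) \<and>
     (\<exists>\<theta>\<in>timings S. \<forall>l i j. evt r l = Act i j \<longrightarrow> clk r l = \<theta> (period_no r l) i j)"


section \<open>Deterministic assumption and synchronous execution\<close>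

definition tau_pred_send ::
  "('a, 'e, 'v) redundant_system \<Rightarrow> timing \<Rightarrow> nat \<Rightarrow> 'a \<Rightarrow> nat \<Rightarrow> nat \<Rightarrow> ereal" where
  "tau_pred_send R \<theta> m a \<beta> i =
     (if \<exists>\<alpha><\<beta>. program R ! \<alpha> = Send a
      then ereal (\<theta> m i (GREATEST \<alpha>. \<alpha> < \<beta> \<and> program R ! \<alpha> = Send a)) else - \<infinity>)"

definition tau_succ_send ::
  "('a, 'e, 'v) redundant_system \<Rightarrow> timing \<Rightarrow> nat \<Rightarrow> 'a \<Rightarrow> nat \<Rightarrow> nat \<Rightarrow> ereal" where
  "tau_succ_send R \<theta> m a \<beta> i =
     (if \<exists>\<gamma>>\<beta>. \<gamma> < length (program R) \<and> program R ! \<gamma> = Send a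
      then ereal (\<theta> m i (LEAST \<gamma>. \<beta> < \<gamma> \<and> \<gamma> < length (program R) \<and> program R ! \<gamma> = Send a))
      else \<infinity>)"

definition deterministic_assumption :: "('a, 'e, 'v) gca \<Rightarrow> bool" where
  "deterministic_assumption S \<longleftrightarrow>
     (let R = redundant S in
      \<forall>\<theta>\<in>timings S. \<forall>m a. \<forall>\<beta><length (program R). program R ! \<beta> = Receive a \<longrightarrow>
        (\<forall>i\<in>machines R. \<forall>j\<in>machines R. \<forall>k\<in>machines R.
           tau_pred_send R \<theta> m a \<beta> i < ereal (\<theta> m j \<beta>) \<and>
           ereal (\<theta> m j \<beta>) < tau_succ_send R \<theta> m a \<beta> k))"

text \<open>
  The second conjunct says that consecutive synchronous activations have different readings.  Without
  it, a send and a later receive of all machines could share one reading and be interleaved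
  arbitrarily, so that equal readings would no longer force the machines to proceed action by
  action.
\<close>

definition synchronous :: "('a, 'e, 'v) gca \<Rightarrow> bool" where
  "synchronous S \<longleftrightarrow>
     (let R = redundant S in
      \<forall>\<theta>\<in>timings S. \<forall>m. \<forall>j<length (program R).
        (\<forall>i\<in>machines R. \<forall>i'\<in>machines R. \<theta> m i j = \<theta> m i' j) \<and>
        (\<forall>i\<in>machines R. \<forall>j'<j. \<theta> m i j' < \<theta> m i j))"

definition same_components :: "('a, 'e, 'v) gca \<Rightarrow> ('a, 'e, 'v) gca \<Rightarrow> bool" where
  "same_components S S' \<longleftrightarrow>
     redundant S = redundant S' \<and> env_step S = env_step S' \<and> period S = period S'"


section \<open>Propositional linear temporal logic\<close>

text \<open>The remaining connectives and temporal operators are definable from these as usual.\<close>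

datatype (atoms: 'p) pltl =
    PTrue
  | Atom 'p
  | Neg "'p pltl"
  | Conj "'p pltl" "'p pltl"
  | X "'p pltl"
  | Until "'p pltl" "'p pltl"

primrec next_free :: "'p pltl \<Rightarrow> bool" where
  "next_free PTrue \<longleftrightarrow> True"
| "next_free (Atom p) \<longleftrightarrow> True"
| "next_free (Neg \<phi>) \<longleftrightarrow> next_free \<phi>"
| "next_free (Conj \<phi> \<psi>) \<longleftrightarrow> next_free \<phi> \<and> next_free \<psi>"
| "next_free (X \<phi>) \<longleftrightarrow> False"
| "next_free (Until \<phi> \<psi>) \<longleftrightarrow> next_free \<phi> \<and> next_free \<psi>"

primrec sat :: "('s \<Rightarrow> 'p \<Rightarrow> bool) \<Rightarrow> (nat \<Rightarrow> 's) \<Rightarrow> nat \<Rightarrow> 'p pltl \<Rightarrow> bool" where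
  "sat I w l PTrue \<longleftrightarrow> True"
| "sat I w l (Atom p) \<longleftrightarrow> I (w l) p"
| "sat I w l (Neg \<phi>) \<longleftrightarrow> \<not> sat I w l \<phi>"
| "sat I w l (Conj \<phi> \<psi>) \<longleftrightarrow> sat I w l \<phi> \<and> sat I w l \<psi>"
| "sat I w l (X \<phi>) \<longleftrightarrow> sat I w (Suc l) \<phi>"
| "sat I w l (Until \<phi> \<psi>) \<longleftrightarrow>
     (\<exists>u\<ge>l. sat I w u \<psi> \<and> (\<forall>s. l \<le> s \<and> s < u \<longrightarrow> sat I w s \<phi>))"


section \<open>Propositional variables\<close>

text \<open>\<open>Cell i a m\<close> is the copy of \<open>a[m]\<close> in machine \<open>i\<close>, and \<open>Next_of i\<close> is the next action of \<open>i\<close>.\<close>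

datatype 'a var = Cell nat 'a nat | Next_of nat

datatype (exp_vars: 'x, 'v) exp =
    Plus "('x, 'v) exp" "('x, 'v) exp"
  | Times "('x, 'v) exp" "('x, 'v) exp"
  | Divide "('x, 'v) exp" "('x, 'v) exp"
  | Var 'x
  | MinusVar 'x
  | Const 'v

datatype ('a, 'v) state_prop = Equals "('a var, 'v) exp" 'v

primrec prop_vars :: "('a, 'v) state_prop \<Rightarrow> 'a var set" where
  "prop_vars (Equals e c) = exp_vars e"

definition local_vars :: "('a, 'e, 'v) redundant_system \<Rightarrow> nat \<Rightarrow> 'a var set" where
  "local_vars R i = {Cell i a m | a m. m \<in> machines R} \<union> {Next_of i}"

text \<open>
  For the next action to occur in arithmetic expressions it has to be represented by a value;
  the representation \<open>code\<close> is a parameter.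
\<close>

primrec var_val ::
  "(nat option \<Rightarrow> 'v) \<Rightarrow> ('a, 'e, 'v) config \<Rightarrow> 'a var \<Rightarrow> 'v" where
  "var_val code c (Cell i a m) = vars (c i) a m"
| "var_val code c (Next_of i) = code (nxt (c i))"

primrec exp_val ::
  "('x \<Rightarrow> 'v) \<Rightarrow> ('x, 'v :: {plus, times, divide, uminus}) exp \<Rightarrow> 'v" where
  "exp_val f (Plus e e') = exp_val f e + exp_val f e'"
| "exp_val f (Times e e') = exp_val f e * exp_val f e'"
| "exp_val f (Divide e e') = exp_val f e div exp_val f e'"
| "exp_val f (Var x) = f x"
| "exp_val f (MinusVar x) = - f x"
| "exp_val f (Const c) = c"

primrec prop_holds ::
  "(nat option \<Rightarrow> 'v) \<Rightarrow> ('a, 'e, 'v) config \<Rightarrow>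
   ('a, 'v :: {plus, times, divide, uminus}) state_prop \<Rightarrow> bool" where
  "prop_holds code c (Equals e b) \<longleftrightarrow> exp_val (var_val code c) e = b"

definition models ::
  "(nat option \<Rightarrow> 'v) \<Rightarrow> ('a, 'e, 'v) gca \<Rightarrow>
   ('a, 'v :: {plus, times, divide, uminus}) state_prop pltl \<Rightarrow> bool" where
  "models code S \<phi> \<longleftrightarrow> (\<forall>r. execution S r \<longrightarrow> sat (prop_holds code) (cfg r) 0 \<phi>)"

end

theory Submission imports Defs begin

text \<open>
  The values that one machine goes through, with repetitions removed, do not depend on the
  interleaving: they are those of the execution in which all machines proceed in lock-step, and
  hence a function of the initial configuration and of the outcomes of the jumps.  Indeed, other
  machines influence machine \<open>i\<close> only through receives, and by the deterministic assumption a
  receive sees exactly the sends that precede it in the program.  Synchronous timings are race free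
  in the same sense.  As every timing can be scheduled with prescribed outcomes of the jumps, each
  execution of one system has a counterpart in the other that differs, at machine \<open>i\<close>, only by
  stuttering, to which formulas without \<open>X\<close> are insensitive.
\<close>

section \<open>Stuttering\<close>

lemma sat_stuttering:
  fixes h :: "nat \<Rightarrow> nat"
  assumes "next_free \<phi>"
    and "\<And>l p. p \<in> atoms \<phi> \<Longrightarrow> I (w l) p \<longleftrightarrow> I (W (h l)) p"
    and h_Suc: "\<And>l. h (Suc l) = h l \<or> h (Suc l) = Suc (h l)"
    and h_unbounded: "\<And>b. \<exists>l. b \<le> h l"
  shows "sat I w l \<phi> \<longleftrightarrow> sat I W (h l) \<phi>"
proof -
  have mono_h: "mono h"
    unfolding mono_iff_le_Suc by (metis h_Suc le_Suc_eq order_refl)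
  have onto_h: "\<exists>l'\<ge>l. h l' = b" if "h l \<le> b" for l b
  proof -
    obtain l1 where l1: "b \<le> h l1" using h_unbounded by blast
    define l' where "l' = (LEAST x. l \<le> x \<and> b \<le> h x)"
    have ex: "l \<le> max l l1 \<and> b \<le> h (max l l1)"
      using l1 monoD[OF mono_h, of l1 "max l l1"] by auto
    have l': "l \<le> l'" "b \<le> h l'"
      unfolding l'_def using LeastI[of "\<lambda>x. l \<le> x \<and> b \<le> h x", OF ex] by auto
    have "h l' = b"
    proof (cases "l' = l")
      case True
      with that l' show ?thesis by simp
    next
      case False
      then obtain x where x: "l' = Suc x" "l \<le> x" using l'(1) by (cases l') auto
      have "\<not> b \<le> h x"
        using not_less_Least[of x "\<lambda>x. l \<le> x \<and> b \<le> h x"] x by (auto simp: l'_def)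
      then show ?thesis using h_Suc[of x] l'(2) x(1) by auto
    qed
    with l' show ?thesis by blast
  qed
  show ?thesis
    using assms(1,2)
  proof (induction \<phi> arbitrary: l)
    case (Until \<phi> \<psi>)
    have 1: "sat I w l \<phi> \<longleftrightarrow> sat I W (h l) \<phi>" for l
      using Until.prems by (intro Until.IH) auto
    have 2: "sat I w l \<psi> \<longleftrightarrow> sat I W (h l) \<psi>" for l
      using Until.prems by (intro Until.IH) auto
    show ?case
    proof
      assume "sat I w l (Until \<phi> \<psi>)"
      then obtain u where u: "u \<ge> l" "sat I w u \<psi>" "\<And>s. l \<le> s \<Longrightarrow> s < u \<Longrightarrow> sat I w s \<phi>"
        by auto
      have "sat I W s \<phi>" if s: "h l \<le> s" "s < h u" for s
      proof -
        obtain l' where l': "l \<le> l'" "h l' = s" using onto_h s(1) by blast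
        then have "l' < u" using s(2) monoD[OF mono_h, of u l'] by (metis leD not_le_imp_less)
        then show ?thesis using u(3) l' 1 by blast
      qed
      then show "sat I W (h l) (Until \<phi> \<psi>)"
        using u 2 monoD[OF mono_h u(1)] by auto
    next
      assume "sat I W (h l) (Until \<phi> \<psi>)"
      then obtain u where u: "u \<ge> h l" "sat I W u \<psi>"
        "\<And>s. h l \<le> s \<Longrightarrow> s < u \<Longrightarrow> sat I W s \<phi>" by auto
      define l' where "l' = (LEAST x. l \<le> x \<and> h x = u)"
      obtain x where "l \<le> x \<and> h x = u" using onto_h u(1) by blast
      then have l': "l \<le> l'" "h l' = u"
        unfolding l'_def using LeastI[of "\<lambda>x. l \<le> x \<and> h x = u" x] by auto
      have "sat I w s \<phi>" if s: "l \<le> s" "s < l'" for s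
      proof -
        have "h s \<noteq> u" using not_less_Least[of s "\<lambda>x. l \<le> x \<and> h x = u"] s by (auto simp: l'_def)
        then have "h s < u" using monoD[OF mono_h, of s l'] s l' by simp
        then show ?thesis using u(3) 1 monoD[OF mono_h s(1)] by blast
      qed
      then show "sat I w l (Until \<phi> \<psi>)" using u l' 2 by auto
    qed
  qed auto
qed


section \<open>The lock-step execution\<close>

text \<open>
  The value that a receive of \<open>a\<close> would give to the copy of \<open>a[i']\<close> in machine \<open>i\<close>.  It is not
  affected by the receive itself, but only by the sends of \<open>i'\<close>.
\<close>

definition latest :: "('a, 'e, 'v) config \<Rightarrow> nat \<Rightarrow> 'a \<Rightarrow> nat \<Rightarrow> 'v" where
  "latest c i a i' =
     (if msgs (a, i') (queue (c i)) = [] then vars (c i) a i' else last (msgs (a, i') (queue (c i))))"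

text \<open>A state consists of the values and the \<open>latest\<close> values; \<open>\<eta>\<close> gives the environments.\<close>

fun round_step ::
  "('a, 'e, 'v) redundant_system \<Rightarrow> (nat \<Rightarrow> 'e \<Rightarrow> 'v) \<Rightarrow> ('a, 'e, 'v) action \<Rightarrow>
   (nat \<Rightarrow> 'a \<Rightarrow> nat \<Rightarrow> 'v) \<times> (nat \<Rightarrow> 'a \<Rightarrow> nat \<Rightarrow> 'v) \<Rightarrow>
   (nat \<Rightarrow> 'a \<Rightarrow> nat \<Rightarrow> 'v) \<times> (nat \<Rightarrow> 'a \<Rightarrow> nat \<Rightarrow> 'v)" where
  "round_step R \<eta> (Assign a e) (v, w) =
     (\<lambda>i. (v i)(a := (v i a)(i := e (\<eta> i) (\<lambda>b d. v i b (cyc_add (size_of R) i d)))), w)"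
| "round_step R \<eta> (Send a) (v, w) = (v, \<lambda>i. (w i)(a := \<lambda>i'. v i' a i'))"
| "round_step R \<eta> (Receive a) (v, w) =
     (\<lambda>i. (v i)(a := \<lambda>i'. if i' \<in> machines R - {i} then w i a i' else v i a i'), w)"

primrec rounds where
  "rounds R \<eta> 0 s = s"
| "rounds R \<eta> (Suc p) s = round_step R \<eta> (program R ! p) (rounds R \<eta> p s)"

text \<open>
  \<open>lockstep R E c m p\<close> is the state after \<open>m\<close> jumps and \<open>p\<close> further actions of every machine,
  where \<open>E m\<close> gives the environments after jump \<open>m\<close>, counted from 0.
\<close>

primrec lockstep ::
  "('a, 'e, 'v) redundant_system \<Rightarrow> (nat \<Rightarrow> nat \<Rightarrow> 'e \<Rightarrow> 'v) \<Rightarrow> ('a, 'e, 'v) config \<Rightarrow> nat \<Rightarrow> nat \<Rightarrow>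
   (nat \<Rightarrow> 'a \<Rightarrow> nat \<Rightarrow> 'v) \<times> (nat \<Rightarrow> 'a \<Rightarrow> nat \<Rightarrow> 'v)" where
  "lockstep R E c 0 = (\<lambda>p. (\<lambda>i. vars (c i), latest c))"
| "lockstep R E c (Suc m) = (\<lambda>p. rounds R (E m) p (lockstep R E c m (length (program R))))"

lemma lockstep_Suc:
  "0 < m \<Longrightarrow>
   lockstep R E c m (Suc p) = round_step R (E (m - 1)) (program R ! p) (lockstep R E c m p)"
  by (cases m) auto

lemma snd_lockstep_no_send:
  assumes "0 < m" "p \<le> p'" "\<And>q. p \<le> q \<Longrightarrow> q < p' \<Longrightarrow> program R ! q \<noteq> Send a"
  shows "snd (lockstep R E c m p') i a = snd (lockstep R E c m p) i a"
  using assms(2,3)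
proof (induction p' rule: dec_induct)
  case (step q)
  obtain v w where vw: "lockstep R E c m q = (v, w)" by fastforce
  have "program R ! q \<noteq> Send a" using step by simp
  then have "snd (lockstep R E c m (Suc q)) i a = snd (lockstep R E c m q) i a"
    using assms(1) vw by (cases "program R ! q") (auto simp: lockstep_Suc)
  then show ?case using step by simp
qed simp

lemma msgs_append [simp]: "msgs x (q @ q') = msgs x q @ msgs x q'"
  by (simp add: msgs_def)

lemma msgs_Cons [simp]: "msgs x (msg # q) = (if fst msg = x then snd msg # msgs x q else msgs x q)"
  by (simp add: msgs_def)

lemma msgs_Nil [simp]: "msgs x [] = []"
  by (simp add: msgs_def)

lemma msgs_filter: "msgs x (filter (\<lambda>msg. fst msg \<notin> A) q) = (if x \<in> A then [] else msgs x q)"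
  by (induction q) auto

lemma vars_advance [simp]: "vars (advance R i j c x) = vars (c x)"
  by (simp add: advance_def)

lemma latest_advance [simp]: "latest (advance R i j c) = latest c"
  by (intro ext) (simp add: advance_def latest_def)

lemma latest_perform:
  assumes "x \<in> machines R" "x' \<in> machines R" "x \<noteq> x'"
  shows "latest (perform R i act c) x a x' =
     (if act = Send a \<and> x' = i then vars (c i) a i else latest c x a x')"
  using assms by (cases act) (auto simp: latest_def msgs_filter)

lemma vars_perform:
  "vars (perform R i act c x) =
     (if x = i then fst (round_step R (\<lambda>i. env (c i)) act (\<lambda>i. vars (c i), latest c)) i
      else vars (c x))"
  by (cases act) (auto simp: latest_def fun_eq_iff)

lemma fst_round_step_cong:
  assumes "\<eta> i = \<eta>' i" "fst s i = fst s' i"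
    and "\<And>a i'. act = Receive a \<Longrightarrow> i' \<in> machines R - {i} \<Longrightarrow> snd s i a i' = snd s' i a i'"
  shows "fst (round_step R \<eta> act s) i = fst (round_step R \<eta>' act s') i"
  using assms by (cases s; cases s'; cases act) (auto intro!: ext)

lemma snd_round_step:
  "snd (round_step R \<eta> act s) i a i' = (if act = Send a then fst s i' a i' else snd s i a i')"
  by (cases s; cases act) auto

text \<open>
  The behaviour of every single machine with stuttering removed, indexed by its number of steps
  plus the length of the program, as before the first jump a machine looks as if it had completed
  the program.
\<close>

definition view ::
  "('a, 'e, 'v) redundant_system \<Rightarrow> (nat \<Rightarrow> nat \<Rightarrow> 'e \<Rightarrow> 'v) \<Rightarrow> ('a, 'e, 'v) config \<Rightarrow> nat \<Rightarrow>
   ('a, 'e, 'v) config" where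
  "view R E c q =
     (let k = length (program R); m = q div Suc k; p = q mod Suc k in
      (\<lambda>i. \<lparr>vars = fst (lockstep R E c m p) i, env = undefined, queue = [],
            nxt = if p < k then Some p else None\<rparr>))"

definition own_values where
  "own_values R E c m =
     (\<lambda>x a. if x \<in> machines R then fst (lockstep R E c m (length (program R))) x a x
            else vars (c x) a x)"

definition environments where
  "environments R E c m = (\<lambda>x. if x \<in> machines R \<and> 0 < m then E (m - 1) x else env (c x))"

definition pos :: "('a, 'e, 'v) redundant_system \<Rightarrow> ('a, 'e, 'v) config \<Rightarrow> nat \<Rightarrow> nat" where
  "pos R c i = (case nxt (c i) of None \<Rightarrow> length (program R) | Some j \<Rightarrow> j)"


section \<open>Timed runs\<close>

definition njumps :: "('a, 'e, 'v) run \<Rightarrow> nat \<Rightarrow> nat" where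
  "njumps r l = card {l'. l' < l \<and> evt r l' = Jump}"

lemma njumps_0 [simp]: "njumps r 0 = 0"
  by (simp add: njumps_def)

lemma njumps_Suc [simp]:
  "njumps r (Suc l) = (if evt r l = Jump then Suc (njumps r l) else njumps r l)"
proof -
  have "{l'. l' < Suc l \<and> evt r l' = Jump} =
      (if evt r l = Jump then insert l {l'. l' < l \<and> evt r l' = Jump}
       else {l'. l' < l \<and> evt r l' = Jump})"
    by (auto simp: less_Suc_eq)
  then show ?thesis by (simp add: njumps_def)
qed

lemma njumps_strict_mono:
  assumes "l < l'" "evt r l = Jump"
  shows "njumps r l < njumps r l'"
proof -
  have "Suc l \<le> l'" using assms by simp
  then have "njumps r (Suc l) \<le> njumps r l'" by (induction l' rule: dec_induct) auto
  then show ?thesis using assms by simp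
qed

lemma njumps_inj:
  "evt r l = Jump \<Longrightarrow> evt r l' = Jump \<Longrightarrow> njumps r l = njumps r l' \<Longrightarrow> l = l'"
  by (metis njumps_strict_mono less_irrefl linorder_neqE_nat)

lemma ex_njumps:
  assumes "\<And>l. \<exists>l'\<ge>l. evt r l' = Jump"
  shows "\<exists>l. evt r l = Jump \<and> njumps r l = m"
proof (induction m)
  case 0
  define l where "l = (LEAST l. evt r l = Jump)"
  obtain x where "evt r x = Jump" using assms[of 0] by auto
  then have "evt r l = Jump"
    unfolding l_def using LeastI[of "\<lambda>l. evt r l = Jump" x] by simp
  moreover have "{l'. l' < l \<and> evt r l' = Jump} = {}"
    using not_less_Least[of _ "\<lambda>l. evt r l = Jump"] unfolding l_def by blast
  ultimately show ?case by (intro exI[of _ l]) (simp only: njumps_def card.empty simp_thms)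
next
  case (Suc m)
  then obtain l0 where l0: "evt r l0 = Jump" "njumps r l0 = m" by blast
  define l where "l = (LEAST l. l0 < l \<and> evt r l = Jump)"
  obtain x where "l0 < x \<and> evt r x = Jump" using assms[of "Suc l0"] Suc_le_eq by blast
  then have l: "l0 < l" "evt r l = Jump"
    unfolding l_def using LeastI[of "\<lambda>l. l0 < l \<and> evt r l = Jump" x] by auto
  have no: "evt r q \<noteq> Jump" if "l0 < q" "q < l" for q
    using not_less_Least[of q "\<lambda>l. l0 < l \<and> evt r l = Jump"] that by (auto simp: l_def)
  have "njumps r q = Suc m" if "Suc l0 \<le> q" "q \<le> l" for q
    using that
  proof (induction q rule: dec_induct)
    case (step q)
    then show ?case using no[of q] by simp
  qed (use l0 in simp)
  from this[of l] show ?case using l by (intro exI[of _ l]) simp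
qed

fun timed_step ::
  "('a, 'e, 'v) redundant_system \<Rightarrow> timing \<Rightarrow> (nat \<Rightarrow> nat \<Rightarrow> 'e \<Rightarrow> 'v) \<Rightarrow> nat \<Rightarrow> event \<Rightarrow>
   ('a, 'e, 'v) config \<times> real \<Rightarrow> ('a, 'e, 'v) config \<times> real \<Rightarrow> bool" where
  "timed_step R \<theta> E m (Act i j) (c, t) (c', t') \<longleftrightarrow>
     i \<in> machines R \<and> nxt (c i) = Some j \<and> j < length (program R) \<and>
     c' = advance R i j (perform R i (program R ! j) c) \<and> t' = t \<and> t = \<theta> (m - 1) i j"
| "timed_step R \<theta> E m Jump (c, t) (c', t') \<longleftrightarrow>
     (\<forall>i\<in>machines R. nxt (c i) = None) \<and>
     c' = (\<lambda>x. if x \<in> machines R then c x\<lparr>env := E m x, nxt := Some 0\<rparr> else c x) \<and> t' = t"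
| "timed_step R \<theta> E m Tick (c, t) (c', t') \<longleftrightarrow> c' = c \<and> t < t'"

definition race_free :: "('a, 'e, 'v) redundant_system \<Rightarrow> timing \<Rightarrow> bool" where
  "race_free R \<theta> \<longleftrightarrow>
     (\<forall>m a. \<forall>\<beta><length (program R). \<forall>\<alpha><length (program R).
        program R ! \<beta> = Receive a \<longrightarrow> program R ! \<alpha> = Send a \<longrightarrow>
        (\<forall>i\<in>machines R. \<forall>j\<in>machines R.
           (\<alpha> < \<beta> \<longrightarrow> \<theta> m i \<alpha> < \<theta> m j \<beta>) \<and> (\<beta> < \<alpha> \<longrightarrow> \<theta> m j \<beta> < \<theta> m i \<alpha>)))"

locale timed_run =
  fixes R :: "('a, 'e, 'v) redundant_system" and \<theta> :: timing
    and E :: "nat \<Rightarrow> nat \<Rightarrow> 'e \<Rightarrow> 'v" and r :: "('a, 'e, 'v) run"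
  assumes nonempty: "program R \<noteq> []"
    and start: "i \<in> machines R \<Longrightarrow> nxt (cfg r 0 i) = None"
    and timed: "timed_step R \<theta> E (njumps r l) (evt r l)
      (cfg r l, clk r l) (cfg r (Suc l), clk r (Suc l))"
    and jumps: "\<exists>l'\<ge>l. evt r l' = Jump"
    and ordered: "i \<in> machines R \<Longrightarrow> j' \<le> j \<Longrightarrow> j < length (program R) \<Longrightarrow> \<theta> m i j' \<le> \<theta> m i j"
    and race_free: "race_free R \<theta>"
begin

abbreviation len :: nat where "len \<equiv> length (program R)"
abbreviation pc :: "nat \<Rightarrow> nat \<Rightarrow> nat" where "pc l i \<equiv> pos R (cfg r l) i"

lemma actD:
  assumes "evt r l = Act i j"
  shows "i \<in> machines R" "nxt (cfg r l i) = Some j" "j < len"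
    "cfg r (Suc l) = advance R i j (perform R i (program R ! j) (cfg r l))"
    "clk r (Suc l) = clk r l" "clk r l = \<theta> (njumps r l - 1) i j" "pc l i = j"
  using timed[of l] assms by (auto simp: pos_def)

lemma jumpD:
  assumes "evt r l = Jump"
  shows "i \<in> machines R \<Longrightarrow> nxt (cfg r l i) = None" "i \<in> machines R \<Longrightarrow> pc l i = len"
    "cfg r (Suc l) = (\<lambda>x. if x \<in> machines R
       then cfg r l x\<lparr>env := E (njumps r l) x, nxt := Some 0\<rparr> else cfg r l x)"
    "clk r (Suc l) = clk r l"
  using timed[of l] assms by (auto simp: pos_def)

lemma tickD:
  assumes "evt r l = Tick"
  shows "cfg r (Suc l) = cfg r l" "clk r l < clk r (Suc l)"
  using timed[of l] assms by auto

lemma nxt_Suc: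
  "nxt (cfg r (Suc l) i) =
     (case evt r l of Act i' j \<Rightarrow> if i' = i then (if Suc j < len then Some (Suc j) else None) else nxt (cfg r l i)
      | Jump \<Rightarrow> if i \<in> machines R then Some 0 else nxt (cfg r l i)
      | Tick \<Rightarrow> nxt (cfg r l i))"
proof (cases "evt r l")
  case (Act i' j)
  show ?thesis
    using actD(4)[OF Act] Act by (cases "program R ! j") (auto simp: advance_def)
qed (auto simp: jumpD(3) tickD(1))

lemma env_Suc:
  "env (cfg r (Suc l) i) =
     (if evt r l = Jump \<and> i \<in> machines R then E (njumps r l) i else env (cfg r l i))"
proof (cases "evt r l")
  case (Act i' j)
  show ?thesis
    using actD(4)[OF Act] Act by (cases "program R ! j") (auto simp: advance_def)
qed (auto simp: jumpD(3) tickD(1))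

lemma pc_Suc:
  assumes "i \<in> machines R"
  shows "pc (Suc l) i =
     (case evt r l of Act i' j \<Rightarrow> if i' = i then Suc (pc l i) else pc l i | Jump \<Rightarrow> 0 | Tick \<Rightarrow> pc l i)"
proof (cases "evt r l")
  case (Act i' j)
  show ?thesis
    using actD[OF Act] Act nxt_Suc[of l i] by (auto simp: pos_def)
qed (use nxt_Suc[of l i] assms in \<open>auto simp: pos_def\<close>)

lemma pc_le: "i \<in> machines R \<Longrightarrow> pc l i \<le> len"
proof (induction l)
  case 0
  then show ?case by (simp add: pos_def start)
next
  case (Suc l)
  then show ?case using pc_Suc[of i l] actD[of l] by (auto split: event.splits)
qed

lemma nxt_pc: "i \<in> machines R \<Longrightarrow> nxt (cfg r l i) = (if pc l i < len then Some (pc l i) else None)"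
proof (induction l)
  case 0
  then show ?case by (simp add: pos_def start)
next
  case (Suc l)
  then show ?case using nxt_Suc[of l i] by (cases "evt r l") (auto simp: pos_def nonempty dest: actD)
qed

lemma nxt_no_jump:
  "njumps r l = 0 \<Longrightarrow> i \<in> machines R \<Longrightarrow> nxt (cfg r l i) = None"
proof (induction l)
  case (Suc l)
  then have "evt r l \<noteq> Jump" "nxt (cfg r l i) = None" by (auto split: if_splits)
  then show ?case using nxt_Suc[of l i] by (cases "evt r l") (auto dest: actD(2))
qed (simp add: start)

lemma act_njumps: "evt r l = Act i j \<Longrightarrow> 0 < njumps r l"
  using nxt_no_jump[of l i] actD(1,2)[of l i j] by (cases "njumps r l = 0") auto

lemma clk_Suc: "clk r l \<le> clk r (Suc l)"
  using jumpD(4) actD(5) tickD(2) by (cases "evt r l") (auto intro: less_imp_le)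

lemma performed:
  "i \<in> machines R \<Longrightarrow> 0 < njumps r l \<Longrightarrow> j < pc l i \<Longrightarrow> \<theta> (njumps r l - 1) i j \<le> clk r l"
proof (induction l arbitrary: j)
  case (Suc l)
  show ?case
  proof (cases "evt r l")
    case (Act i' j')
    have pos: "0 < njumps r l" using Suc.prems Act by simp
    have "\<theta> (njumps r l - 1) i j \<le> clk r l"
    proof (cases "j < pc l i")
      case True
      then show ?thesis using Suc.IH[OF Suc.prems(1) pos] by simp
    next
      case False
      then have "i' = i" "j' = j"
        using Suc.prems(3) pc_Suc[OF Suc.prems(1), of l] Act actD(7)[OF Act]
        by (auto split: if_splits)
      then show ?thesis using actD(6)[OF Act] by simp
    qed
    then show ?thesis using Act actD(5)[OF Act] by simp
  next
    case Jump
    then show ?thesis using Suc pc_Suc[of i l] by simp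
  next
    case Tick
    then have "\<theta> (njumps r l - 1) i j \<le> clk r l"
      using Suc pc_Suc[of i l] by simp
    then show ?thesis using Tick clk_Suc[of l] by simp
  qed
qed simp

lemma pending:
  assumes "i \<in> machines R" "pc l i \<le> j" "j < len"
  shows "clk r l \<le> \<theta> (njumps r l - 1) i j"
proof -
  obtain l' where "l \<le> l'" "evt r l' = Jump" using jumps by blast
  then show ?thesis
    using assms(2)
  proof (induction l rule: inc_induct)
    case base
    then show ?case using jumpD(2)[of l' i] assms by simp
  next
    case (step l)
    show ?case
    proof (cases "evt r l")
      case (Act i' j')
      show ?thesis
      proof (cases "i' = i \<and> j' = j")
        case True
        then show ?thesis using actD[OF Act] by simp
      next
        case False
        have "pc (Suc l) i \<le> j"
          using False pc_Suc[OF assms(1), of l] Act actD(7)[OF Act] step.prems by auto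
        then show ?thesis using step Act actD(5)[OF Act] by simp
      qed
    next
      case Jump
      then show ?thesis using jumpD(2) assms(1,3) step.prems by simp
    next
      case Tick
      then have "clk r (Suc l) \<le> \<theta> (njumps r l - 1) i j"
        using step pc_Suc[OF assms(1), of l] by simp
      then show ?thesis using clk_Suc[of l] by simp
    qed
  qed
qed

text \<open>
  When a machine receives \<open>a\<close>, the other machines may be ahead or behind, but race freedom rules
  out that they have a send of \<open>a\<close> on the way to the receive.
\<close>

lemma receive_lockstep:
  assumes act: "evt r l = Act i \<beta>" "program R ! \<beta> = Receive a" and i': "i' \<in> machines R"
  shows "snd (lockstep R E c (njumps r l) (pc l i')) x a = snd (lockstep R E c (njumps r l) \<beta>) x a"
proof -
  note act' = actD[OF act(1)]
  have not_send: "program R ! q \<noteq> Send a"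
    if "pc l i' \<le> q \<and> q < \<beta> \<or> \<beta> \<le> q \<and> q < pc l i'" for q
  proof
    assume q: "program R ! q = Send a"
    with act(2) have "q \<noteq> \<beta>" by auto
    have "q < len" using that act'(3) pc_le[OF i', of l] by auto
    then have *: "(q < \<beta> \<longrightarrow> \<theta> (njumps r l - 1) i' q < clk r l) \<and> (\<beta> < q \<longrightarrow> clk r l < \<theta> (njumps r l - 1) i' q)"
      using race_free[unfolded race_free_def, rule_format, OF act'(3) _ act(2) q i' act'(1)]
      by (simp add: act'(6))
    show False
      using that
    proof
      assume "pc l i' \<le> q \<and> q < \<beta>"
      then show False using * pending[OF i', of l q] \<open>q < len\<close> by auto
    next
      assume "\<beta> \<le> q \<and> q < pc l i'"
      then show False
        using * performed[OF i' act_njumps[OF act(1)], of q] \<open>q \<noteq> \<beta>\<close> by auto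
    qed
  qed
  show ?thesis
  proof (cases "pc l i' \<le> \<beta>")
    case True
    then show ?thesis
      by (intro snd_lockstep_no_send[symmetric] act_njumps[OF act(1)] not_send) auto
  next
    case False
    then show ?thesis
      by (intro snd_lockstep_no_send act_njumps[OF act(1)] not_send) auto
  qed
qed

lemma outside: "x \<notin> machines R \<Longrightarrow> cfg r l x = cfg r 0 x"
proof (induction l)
  case (Suc l)
  have "cfg r (Suc l) x = cfg r l x"
  proof (cases "evt r l")
    case (Act i j)
    then show ?thesis
      using actD[OF Act] Suc.prems by (cases "program R ! j") (auto simp: advance_def)
  qed (use Suc.prems in \<open>auto simp: jumpD(3) tickD(1)\<close>)
  then show ?case using Suc by simp
qed simp

lemma env_run: "i \<in> machines R \<Longrightarrow>
   env (cfg r l i) = (if njumps r l = 0 then env (cfg r 0 i) else E (njumps r l - 1) i)"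
proof (induction l)
  case (Suc l)
  then show ?case by (simp add: env_Suc)
qed simp

abbreviation state :: "nat \<Rightarrow> nat \<Rightarrow> (nat \<Rightarrow> 'a \<Rightarrow> nat \<Rightarrow> 'v) \<times> (nat \<Rightarrow> 'a \<Rightarrow> nat \<Rightarrow> 'v)" where
  "state \<equiv> lockstep R E (cfg r 0)"

lemma lockstep_invariant:
  "(\<forall>i\<in>machines R. vars (cfg r l i) = fst (state (njumps r l) (pc l i)) i) \<and>
   (\<forall>i\<in>machines R. \<forall>i'\<in>machines R. \<forall>a. i \<noteq> i' \<longrightarrow>
      latest (cfg r l) i a i' = snd (state (njumps r l) (pc l i')) i a i')"
proof (induction l)
  case (Suc l)
  then have IH1: "\<And>i. i \<in> machines R \<Longrightarrow> vars (cfg r l i) = fst (state (njumps r l) (pc l i)) i"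
    and IH2: "\<And>i i' a. i \<in> machines R \<Longrightarrow> i' \<in> machines R \<Longrightarrow> i \<noteq> i' \<Longrightarrow>
      latest (cfg r l) i a i' = snd (state (njumps r l) (pc l i')) i a i'"
    by blast+
  show ?case
  proof (cases "evt r l")
    case (Act k j)
    note act = actD[OF Act]
    let ?m = "njumps r l" and ?act = "program R ! j"
    have m: "0 < ?m" using act_njumps[OF Act] .
    have next_state: "state ?m (Suc j) = round_step R (E (?m - 1)) ?act (state ?m j)"
      by (rule lockstep_Suc[OF m])
    have m_Suc: "njumps r (Suc l) = ?m" using Act by simp
    have pc: "pc (Suc l) i = (if i = k then Suc j else pc l i)" if "i \<in> machines R" for i
      using pc_Suc[OF that, of l] Act act(7) by simp
    have "vars (cfg r (Suc l) i) = fst (state ?m (pc (Suc l) i)) i" if i: "i \<in> machines R" for i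
    proof (cases "i = k")
      case True
      have "vars (cfg r (Suc l) k) =
          fst (round_step R (\<lambda>i. env (cfg r l i)) ?act (\<lambda>i. vars (cfg r l i), latest (cfg r l))) k"
        unfolding act(4) by (simp only: vars_advance vars_perform if_True simp_thms)
      also have "\<dots> = fst (round_step R (E (?m - 1)) ?act (state ?m j)) k"
      proof (rule fst_round_step_cong)
        show "env (cfg r l k) = E (?m - 1) k"
          using env_run[OF act(1), of l] m by simp
        show "fst (\<lambda>i. vars (cfg r l i), latest (cfg r l)) k = fst (state ?m j) k"
          using IH1[OF act(1)] act(7) by simp
      next
        fix a i'
        assume "?act = Receive a" "i' \<in> machines R - {k}"
        then show "snd (\<lambda>i. vars (cfg r l i), latest (cfg r l)) k a i' = snd (state ?m j) k a i'"
          using IH2[OF act(1), of i' a] receive_lockstep[OF Act, of a i' "cfg r 0" k] by simp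
      qed
      finally show ?thesis
        using pc[OF i] True next_state by simp
    next
      case False
      then have "vars (cfg r (Suc l) i) = vars (cfg r l i)"
        by (simp add: act(4) vars_perform)
      then show ?thesis
        using False IH1[OF i] pc[OF i] by simp
    qed
    moreover have "latest (cfg r (Suc l)) i a i' = snd (state ?m (pc (Suc l) i')) i a i'"
      if "i \<in> machines R" "i' \<in> machines R" "i \<noteq> i'" for i i' a
    proof -
      have "latest (cfg r (Suc l)) i a i' =
          (if ?act = Send a \<and> i' = k then vars (cfg r l k) a k else latest (cfg r l) i a i')"
        unfolding act(4) latest_advance by (rule latest_perform[OF that])
      also have "\<dots> = snd (state ?m (pc (Suc l) i')) i a i'"
        using IH2[OF that, of a] IH1[OF act(1)] act(7) pc[OF that(2)]
        by (auto simp: next_state snd_round_step)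
      finally show ?thesis .
    qed
    ultimately show ?thesis unfolding m_Suc by blast
  next
    case Jump
    have "vars (cfg r (Suc l) i) = vars (cfg r l i)" for i
      by (simp add: jumpD(3)[OF Jump])
    moreover have "latest (cfg r (Suc l)) = latest (cfg r l)"
      by (intro ext) (simp add: jumpD(3)[OF Jump] latest_def)
    moreover have "pc (Suc l) i = 0" if "i \<in> machines R" for i
      using pc_Suc[OF that, of l] Jump by simp
    ultimately show ?thesis
      using IH1 IH2 jumpD(2)[OF Jump] Jump by simp
  next
    case Tick
    then show ?thesis using Suc by (simp add: tickD(1))
  qed
qed simp

lemma view_stuttering:
  assumes i: "i \<in> machines R"
  obtains h where "h 0 = len" "\<And>l. h (Suc l) = h l \<or> h (Suc l) = Suc (h l)" "\<And>b. \<exists>l. b \<le> h l"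
    "\<And>l. vars (cfg r l i) = vars (view R E (cfg r 0) (h l) i)"
    "\<And>l. nxt (cfg r l i) = nxt (view R E (cfg r 0) (h l) i)"
proof -
  define h where "h l = njumps r l * Suc len + pc l i" for l
  have mod_h: "h l mod Suc len = pc l i" and div_h: "h l div Suc len = njumps r l" for l
    using pc_le[OF i, of l] unfolding h_def by (simp_all del: mult_Suc_right)
  have h0: "h 0 = len" by (simp add: h_def pos_def start[OF i])
  have h_Suc: "h (Suc l) = h l \<or> h (Suc l) = Suc (h l)" for l
    using pc_Suc[OF i, of l] jumpD(2)[OF _ i, of l]
    by (cases "evt r l") (auto simp: h_def)
  have unbounded: "\<exists>l. b \<le> h l" for b
  proof -
    obtain l where "njumps r l = b" using ex_njumps[OF jumps] by blast
    then have "b \<le> h l" by (simp add: h_def)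
    then show ?thesis ..
  qed
  have vars: "vars (cfg r l i) = vars (view R E (cfg r 0) (h l) i)"
    and nxt: "nxt (cfg r l i) = nxt (view R E (cfg r 0) (h l) i)" for l
    using lockstep_invariant[of l] i nxt_pc[OF i, of l]
    by (simp_all add: view_def Let_def mod_h div_h)
  show thesis using that[OF h0 h_Suc unbounded vars nxt] .
qed

lemma own_values_at_jump:
  assumes "evt r l = Jump"
  shows "(\<lambda>x a. vars (cfg r l x) a x) = own_values R E (cfg r 0) (njumps r l)"
  using lockstep_invariant[of l] jumpD(2)[OF assms] outside[of _ l]
  by (intro ext) (auto simp: own_values_def)

lemma environments_at_jump:
  "(\<lambda>x. env (cfg r l x)) = environments R E (cfg r 0) (njumps r l)"
proof
  show "env (cfg r l x) = environments R E (cfg r 0) (njumps r l) x" for x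
    using env_run[of x l] outside[of x l] by (cases "x \<in> machines R") (simp_all add: environments_def)
qed

end

lemma prop_holds_cong:
  assumes "prop_vars p \<subseteq> local_vars R i" "vars (c i) = vars (c' i)" "nxt (c i) = nxt (c' i)"
  shows "prop_holds code c p \<longleftrightarrow> prop_holds code c' p"
proof -
  obtain e b where p: "p = Equals e b" by (cases p)
  have "var_val code c x = var_val code c' x" if "x \<in> exp_vars e" for x
    using that assms by (auto simp: p local_vars_def)
  then have "exp_val (var_val code c) e = exp_val (var_val code c') e"
    by (induction e) auto
  then show ?thesis by (simp add: p)
qed

lemma sat_view:
  assumes "timed_run R \<theta> E r" "i \<in> machines R"
    and "next_free \<phi>" "\<forall>p\<in>atoms \<phi>. prop_vars p \<subseteq> local_vars R i"
  shows "sat (prop_holds code) (cfg r) 0 \<phi> \<longleftrightarrow>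
    sat (prop_holds code) (view R E (cfg r 0)) (length (program R)) \<phi>"
proof -
  interpret timed_run R \<theta> E r by fact
  obtain h where h: "h 0 = len" "\<And>l. h (Suc l) = h l \<or> h (Suc l) = Suc (h l)" "\<And>b. \<exists>l. b \<le> h l"
    and same: "\<And>l. vars (cfg r l i) = vars (view R E (cfg r 0) (h l) i)"
    "\<And>l. nxt (cfg r l i) = nxt (view R E (cfg r 0) (h l) i)"
    using view_stuttering[OF assms(2)] by blast
  have "prop_holds code (cfg r l) p \<longleftrightarrow> prop_holds code (view R E (cfg r 0) (h l)) p"
    if "p \<in> atoms \<phi>" for l p
    by (rule prop_holds_cong) (use assms(4) that same in auto)
  from sat_stuttering[OF assms(3), where h = h and l = 0 and w = "cfg r" and W = "view R E (cfg r 0)"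
      and I = "prop_holds code", OF this h(2,3)]
  show ?thesis unfolding h(1) .
qed


section \<open>Scheduling a given timing\<close>

fun scheduled ::
  "('a, 'e, 'v) redundant_system \<Rightarrow> real \<Rightarrow> timing \<Rightarrow> ('a, 'e, 'v) config \<times> real \<times> nat \<Rightarrow> bool" where
  "scheduled R T \<theta> (c, t, m) \<longleftrightarrow>
     t \<le> real m * T \<and>
     (\<forall>i\<in>machines R. \<forall>j. nxt (c i) = Some j \<longrightarrow>
        j < length (program R) \<and> 0 < m \<and> t \<le> \<theta> (m - 1) i j)"

text \<open>Bounds the number of steps before the next jump.\<close>

fun workload ::
  "('a, 'e, 'v) redundant_system \<Rightarrow> real \<Rightarrow> timing \<Rightarrow> ('a, 'e, 'v) config \<times> real \<times> nat \<Rightarrow> nat" where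
  "workload R T \<theta> (c, t, m) =
     2 * (\<Sum>i\<in>machines R. length (program R) - pos R c i) +
     (if t = real m * T \<or> (\<exists>i\<in>machines R. \<exists>j. nxt (c i) = Some j \<and> \<theta> (m - 1) i j = t) then 0 else 1)"

lemma finite_machines: "finite (machines R)"
  by (simp add: machines_def)

lemma nxt_advance_perform:
  "nxt (advance R i j (perform R i act c) x) =
     (if x = i then (if Suc j < length (program R) then Some (Suc j) else None) else nxt (c x))"
  by (cases act) (auto simp: advance_def)

lemma scheduled_step:
  assumes adm: "admissible_timing R T \<theta>" and T: "0 < T" and nonempty: "program R \<noteq> []"
    and sched: "scheduled R T \<theta> (c, t, m)"
  shows "\<exists>e c' t' m'. timed_step R \<theta> E m e (c, t) (c', t') \<and> scheduled R T \<theta> (c', t', m') \<and>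
     m' = (if e = Jump then Suc m else m) \<and>
     (if e = Jump then t = real m * T else workload R T \<theta> (c', t', m') < workload R T \<theta> (c, t, m))"
proof -
  let ?k = "length (program R)"
  let ?due = "\<lambda>t. t = real m * T \<or> (\<exists>i\<in>machines R. \<exists>j. nxt (c i) = Some j \<and> \<theta> (m - 1) i j = t)"
  have tm: "t \<le> real m * T"
    and pend: "\<And>i j. i \<in> machines R \<Longrightarrow> nxt (c i) = Some j \<Longrightarrow> j < ?k \<and> 0 < m \<and> t \<le> \<theta> (m - 1) i j"
    using sched by auto
  have upper: "\<theta> (m - 1) i j \<le> real m * T" if "i \<in> machines R" "nxt (c i) = Some j" for i j
  proof -
    have "0 < m" "j < ?k" using pend[OF that] by auto
    then show ?thesis
      using adm that(1) unfolding admissible_timing_def by (metis Suc_pred')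
  qed
  consider
      (act) i j where "i \<in> machines R" "nxt (c i) = Some j" "\<theta> (m - 1) i j = t"
    | (jump) "\<forall>i\<in>machines R. nxt (c i) = None" "t = real m * T"
    | (tick) "\<not> ?due t"
    using upper pend tm by (metis not_None_eq order_antisym)
  then show ?thesis
  proof cases
    case act
    have j: "j < ?k" and m: "0 < m" using pend[OF act(1,2)] by auto
    define c' where "c' = advance R i j (perform R i (program R ! j) c)"
    have nxt: "nxt (c' x) = (if x = i then (if Suc j < ?k then Some (Suc j) else None) else nxt (c x))" for x
      by (simp add: c'_def nxt_advance_perform)
    have pos: "pos R c' x = (if x = i then Suc j else pos R c x)" for x
      using j by (auto simp: pos_def nxt)
    have "\<theta> (m - 1) i j \<le> \<theta> (m - 1) i (Suc j)" if "Suc j < ?k"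
      using adm act(1) that unfolding admissible_timing_def by blast
    then have "scheduled R T \<theta> (c', t, m)"
      using tm pend act(1,3) m by (auto simp: nxt split: if_splits)
    moreover have "(\<Sum>x\<in>machines R. ?k - pos R c' x) < (\<Sum>x\<in>machines R. ?k - pos R c x)"
    proof (rule sum_strict_mono_ex1[OF finite_machines])
      show "\<forall>x\<in>machines R. ?k - pos R c' x \<le> ?k - pos R c x"
        using act(2) by (auto simp: pos pos_def[of R c i])
      show "\<exists>x\<in>machines R. ?k - pos R c' x < ?k - pos R c x"
        using act(1,2) j by (intro bexI[of _ i]) (auto simp: pos pos_def[of R c i])
    qed
    then have "workload R T \<theta> (c', t, m) < workload R T \<theta> (c, t, m)"
      by simp
    moreover have "timed_step R \<theta> E m (Act i j) (c, t) (c', t)"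
      using act j by (simp add: c'_def)
    ultimately show ?thesis
      by (intro exI[of _ "Act i j"] exI[of _ c'] exI[of _ t] exI[of _ m]) (simp del: workload.simps)
  next
    case jump
    define c' where
      "c' = (\<lambda>x. if x \<in> machines R then c x\<lparr>env := E m x, nxt := Some 0\<rparr> else c x)"
    have "real m * T \<le> \<theta> m i 0" if "i \<in> machines R" for i
      using adm that nonempty unfolding admissible_timing_def by blast
    then have "scheduled R T \<theta> (c', t, Suc m)"
      using jump(2) T nonempty by (auto simp: c'_def algebra_simps)
    moreover have "timed_step R \<theta> E m Jump (c, t) (c', t)"
      using jump by (simp add: c'_def)
    ultimately show ?thesis
      using jump(2)
      by (intro exI[of _ Jump] exI[of _ c'] exI[of _ t] exI[of _ "Suc m"]) simp
  next
    case tick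
    define D where
      "D = insert (real m * T) ((\<lambda>i. \<theta> (m - 1) i (the (nxt (c i)))) ` {i \<in> machines R. nxt (c i) \<noteq> None})"
    have fin: "finite D" by (simp add: D_def finite_machines)
    have "t \<le> d" if "d \<in> D" for d using that tm pend by (auto simp: D_def)
    moreover have due: "?due d" if d: "d \<in> D" for d
    proof -
      consider "d = real m * T" | i j where "i \<in> machines R" "nxt (c i) = Some j" "d = \<theta> (m - 1) i j"
        using d unfolding D_def by force
      then show ?thesis by cases blast+
    qed
    moreover have "Min D \<in> D" using fin by (intro Min_in) (auto simp: D_def)
    ultimately have less: "t < Min D" using tick by (metis order_le_less)
    have le: "Min D \<le> d" if "d \<in> D" for d using fin that by simp
    have "Min D \<le> \<theta> (m - 1) i j" if "i \<in> machines R" "nxt (c i) = Some j" for i j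
      using that by (intro le) (force simp: D_def)
    moreover have "Min D \<le> real m * T" by (intro le) (simp add: D_def)
    ultimately have "scheduled R T \<theta> (c, Min D, m)" using pend by auto
    moreover have "workload R T \<theta> (c, Min D, m) < workload R T \<theta> (c, t, m)"
      using tick due[OF \<open>Min D \<in> D\<close>] by simp
    ultimately show ?thesis
      using less
      by (intro exI[of _ Tick] exI[of _ c] exI[of _ "Min D"] exI[of _ m]) (simp del: workload.simps)
  qed
qed

lemma scheduled_run:
  fixes c :: "('a, 'e, 'v) config"
  assumes adm: "admissible_timing R T \<theta>" and T: "0 < T" and nonempty: "program R \<noteq> []"
    and init: "\<And>i. i \<in> machines R \<Longrightarrow> nxt (c i) = None"
  obtains r :: "('a, 'e, 'v) run" where "cfg r 0 = c" "clk r 0 = 0"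
    "\<And>l. timed_step R \<theta> E (njumps r l) (evt r l)
      (cfg r l, clk r l) (cfg r (Suc l), clk r (Suc l))"
    "\<And>l. evt r l = Jump \<Longrightarrow> clk r l = real (njumps r l) * T"
    "\<And>l. \<exists>l'\<ge>l. evt r l' = Jump"
proof -
  let ?Q = "\<lambda>s e s'. timed_step R \<theta> E (snd (snd s)) e (fst s, fst (snd s)) (fst s', fst (snd s')) \<and>
     snd (snd s') = (if e = Jump then Suc (snd (snd s)) else snd (snd s)) \<and>
     (if e = Jump then fst (snd s) = real (snd (snd s)) * T else workload R T \<theta> s' < workload R T \<theta> s)"
  have "\<exists>f. \<forall>n. (scheduled R T \<theta> (f n) \<and> (n = 0 \<longrightarrow> f n = (c, 0, 0))) \<and> (\<exists>e. ?Q (f n) e (f (Suc n)))"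
  proof (rule dependent_nat_choice)
    show "\<exists>s. scheduled R T \<theta> s \<and> ((0::nat) = 0 \<longrightarrow> s = (c, 0, 0))"
      using init by (intro exI[of _ "(c, 0, 0)"]) simp
  next
    fix s and n :: nat
    assume "scheduled R T \<theta> s \<and> (n = 0 \<longrightarrow> s = (c, 0, 0))"
    moreover obtain c1 t1 m1 where s: "s = (c1, t1, m1)" by (cases s)
    ultimately have "scheduled R T \<theta> (c1, t1, m1)" by simp
    from scheduled_step[OF adm T nonempty this, of E]
    obtain e c' t' m' where step: "timed_step R \<theta> E m1 e (c1, t1) (c', t')"
      "scheduled R T \<theta> (c', t', m')" "m' = (if e = Jump then Suc m1 else m1)"
      "if e = Jump then t1 = real m1 * T
       else workload R T \<theta> (c', t', m') < workload R T \<theta> (c1, t1, m1)" by blast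
    then have "?Q s e (c', t', m')" unfolding s fst_conv snd_conv by blast
    then show "\<exists>s'. (scheduled R T \<theta> s' \<and> (Suc n = 0 \<longrightarrow> s' = (c, 0, 0))) \<and> (\<exists>e. ?Q s e s')"
      using step(2) by blast
  qed
  then obtain f where f0: "f 0 = (c, 0, 0)" and "\<forall>n. \<exists>e. ?Q (f n) e (f (Suc n))" by blast
  then obtain e where e: "\<And>n. ?Q (f n) (e n) (f (Suc n))" by metis
  define r :: "('a, 'e, 'v) run" where
    "r = \<lparr>cfg = \<lambda>l. fst (f l), clk = \<lambda>l. fst (snd (f l)), evt = e\<rparr>"
  have r: "cfg r l = fst (f l)" "clk r l = fst (snd (f l))" "evt r l = e l" for l
    by (simp_all add: r_def)
  have nj: "njumps r l = snd (snd (f l))" for l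
  proof (induction l)
    case (Suc l)
    then show ?case using e[of l] by (simp add: r)
  qed (simp add: f0)
  have "\<exists>l'\<ge>l. evt r l' = Jump" for l
  proof (induction "workload R T \<theta> (f l)" arbitrary: l rule: less_induct)
    case less
    show ?case
    proof (cases "e l = Jump")
      case False
      then have "workload R T \<theta> (f (Suc l)) < workload R T \<theta> (f l)" using e[of l] by presburger
      from less[OF this] show ?thesis by (meson Suc_leD)
    qed (auto simp: r)
  qed
  moreover have "timed_step R \<theta> E (njumps r l) (evt r l)
      (cfg r l, clk r l) (cfg r (Suc l), clk r (Suc l))" for l
    unfolding r nj using e[of l] by blast
  moreover have "clk r l = real (njumps r l) * T" if "evt r l = Jump" for l
    using e[of l] that unfolding r nj by presburger
  ultimately show thesis
    using that[of r] by (simp add: r f0)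
qed


section \<open>Comparing systems\<close>

lemma race_free_deterministic:
  assumes det: "deterministic_assumption S" and adm: "admissible_timing (redundant S) T \<theta>"
    and \<theta>: "\<theta> \<in> timings S"
  shows "race_free (redundant S) \<theta>"
  unfolding race_free_def
proof (intro allI impI ballI)
  fix m a \<beta> \<alpha> i j
  let ?R = "redundant S"
  let ?k = "length (program ?R)"
  assume \<beta>: "\<beta> < ?k" "program ?R ! \<beta> = Receive a" and \<alpha>: "\<alpha> < ?k" "program ?R ! \<alpha> = Send a"
    and ij: "i \<in> machines ?R" "j \<in> machines ?R"
  have taus: "tau_pred_send ?R \<theta> m a \<beta> i < ereal (\<theta> m j \<beta>)" "ereal (\<theta> m j \<beta>) < tau_succ_send ?R \<theta> m a \<beta> i"
    using det \<theta> \<beta> ij unfolding deterministic_assumption_def Let_def by blast+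
  have ordered: "\<theta> m i p \<le> \<theta> m i q" if "p \<le> q" "q < ?k" for p q
    using adm ij(1) that unfolding admissible_timing_def by (cases "p = q") auto
  show "(\<alpha> < \<beta> \<longrightarrow> \<theta> m i \<alpha> < \<theta> m j \<beta>) \<and> (\<beta> < \<alpha> \<longrightarrow> \<theta> m j \<beta> < \<theta> m i \<alpha>)"
  proof (intro conjI impI)
    assume "\<alpha> < \<beta>"
    define p where "p = (GREATEST \<alpha>. \<alpha> < \<beta> \<and> program ?R ! \<alpha> = Send a)"
    have "\<alpha> \<le> p"
      unfolding p_def using \<alpha> \<open>\<alpha> < \<beta>\<close> by (intro Greatest_le_nat[of _ _ \<beta>]) auto
    moreover have "p < \<beta> \<and> program ?R ! p = Send a"
      unfolding p_def by (rule GreatestI_nat[of _ \<alpha> \<beta>]) (use \<alpha> \<open>\<alpha> < \<beta>\<close> in auto)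
    moreover have "\<theta> m i p < \<theta> m j \<beta>"
    proof -
      have "\<exists>\<alpha><\<beta>. program ?R ! \<alpha> = Send a" using \<alpha> \<open>\<alpha> < \<beta>\<close> by blast
      then show ?thesis using taus(1) by (simp add: tau_pred_send_def p_def)
    qed
    ultimately show "\<theta> m i \<alpha> < \<theta> m j \<beta>" using ordered[of \<alpha> p] \<beta>(1) by simp
  next
    assume "\<beta> < \<alpha>"
    define q where "q = (LEAST \<gamma>. \<beta> < \<gamma> \<and> \<gamma> < ?k \<and> program ?R ! \<gamma> = Send a)"
    have "q \<le> \<alpha>" unfolding q_def using \<alpha> \<open>\<beta> < \<alpha>\<close> by (intro Least_le) simp
    moreover have "\<theta> m j \<beta> < \<theta> m i q"
    proof -
      have "\<exists>\<gamma>>\<beta>. \<gamma> < ?k \<and> program ?R ! \<gamma> = Send a" using \<alpha> \<open>\<beta> < \<alpha>\<close> by blast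
      then show ?thesis using taus(2) by (simp add: tau_succ_send_def q_def)
    qed
    ultimately show "\<theta> m j \<beta> < \<theta> m i \<alpha>" using ordered[of q \<alpha>] \<alpha>(1) by simp
  qed
qed

lemma race_free_synchronous:
  assumes sync: "synchronous S" and \<theta>: "\<theta> \<in> timings S"
  shows "race_free (redundant S) \<theta>"
proof -
  let ?R = "redundant S"
  have "\<theta> m i p < \<theta> m j q"
    if "p < q" "q < length (program ?R)" "i \<in> machines ?R" "j \<in> machines ?R" for m i j p q
  proof -
    have "\<theta> m i p < \<theta> m i q" "\<theta> m i q = \<theta> m j q"
      using sync \<theta> that unfolding synchronous_def Let_def by blast+
    then show ?thesis by simp
  qed
  then show ?thesis unfolding race_free_def by blast
qed

lemma timed_runI:
  assumes "gca_system S" "\<theta> \<in> timings S" "race_free (redundant S) \<theta>"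
    and "cfg r 0 \<in> initial (redundant S)"
    and "\<And>l. timed_step (redundant S) \<theta> E (njumps r l) (evt r l)
      (cfg r l, clk r l) (cfg r (Suc l), clk r (Suc l))"
    and "\<And>l. \<exists>l'\<ge>l. evt r l' = Jump"
  shows "timed_run (redundant S) \<theta> E r"
proof
  have adm: "admissible_timing (redundant S) (period S) \<theta>"
    using assms(1,2) by (simp add: gca_system_def)
  show "\<theta> m i j' \<le> \<theta> m i j"
    if "i \<in> machines (redundant S)" "j' \<le> j" "j < length (program (redundant S))" for m i j j'
    using adm that unfolding admissible_timing_def by (cases "j' = j") auto
qed (use assms in \<open>auto simp: gca_system_def\<close>)

definition env_consistent where
  "env_consistent S E c \<longleftrightarrow>
     (\<forall>m. env_step S (own_values (redundant S) E c m) (environments (redundant S) E c m) (E m))"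

lemma execution_jumps:
  assumes "0 < period S" "execution S r"
  shows "\<exists>l'\<ge>l. evt r l' = Jump"
proof -
  have step: "step S (evt r l) (cfg r l, clk r l) (cfg r (Suc l), clk r (Suc l))" for l
    using assms(2) by (simp add: execution_def)
  have "clk r l \<le> clk r (Suc l)" for l using step[of l] by (cases "evt r l") auto
  then have mono: "l1 \<le> l2 \<Longrightarrow> clk r l1 \<le> clk r l2" for l1 l2
    by (rule lift_Suc_mono_le)
  obtain m :: nat where m: "clk r l < real m * period S"
    using reals_Archimedean3[OF assms(1)] by blast
  obtain l' where l': "evt r l' = Jump" "clk r l' = real m * period S"
    using assms(2) unfolding execution_def by blast
  then show ?thesis using mono[of l' l] m by (cases "l \<le> l'") auto
qed

lemma timed_run_execution:
  assumes gca: "gca_system S" and rf: "\<forall>\<theta>\<in>timings S. race_free (redundant S) \<theta>"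
    and exe: "execution S r"
  obtains \<theta> E where "timed_run (redundant S) \<theta> E r" "env_consistent S E (cfg r 0)"
proof -
  let ?R = "redundant S"
  have T: "0 < period S" using gca by (simp add: gca_system_def)
  have step: "step S (evt r l) (cfg r l, clk r l) (cfg r (Suc l), clk r (Suc l))" for l
    using exe by (simp add: execution_def)
  obtain \<theta> where \<theta>: "\<theta> \<in> timings S" "\<And>l i j. evt r l = Act i j \<Longrightarrow> clk r l = \<theta> (njumps r l - 1) i j"
    using exe unfolding execution_def period_no_def njumps_def by blast
  let ?env = "\<lambda>l env'. env_step S (\<lambda>x a. vars (cfg r l x) a x) (\<lambda>x. env (cfg r l x)) env' \<and>
      cfg r (Suc l) = (\<lambda>x. if x \<in> machines ?R then cfg r l x\<lparr>env := env' x, nxt := Some 0\<rparr> else cfg r l x)"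
  have ex_env: "\<exists>env'. ?env l env'" if "evt r l = Jump" for l
    using step[of l] unfolding that step.simps by blast
  define F where "F l = (SOME env'. ?env l env')" for l
  have F: "?env l (F l)" if "evt r l = Jump" for l
    unfolding F_def by (rule someI_ex[OF ex_env[OF that]])
  define E where "E m = F (SOME l. evt r l = Jump \<and> njumps r l = m)" for m
  have E: "E (njumps r l) = F l" if "evt r l = Jump" for l
  proof -
    have "(SOME l'. evt r l' = Jump \<and> njumps r l' = njumps r l) = l"
      using that by (intro some_equality) (auto dest: njumps_inj)
    then show ?thesis by (simp add: E_def)
  qed
  have jumps: "\<exists>l'\<ge>l. evt r l' = Jump" for l by (rule execution_jumps[OF T exe])
  have "timed_step ?R \<theta> E (njumps r l) (evt r l)
      (cfg r l, clk r l) (cfg r (Suc l), clk r (Suc l))" for l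
  proof (cases "evt r l")
    case (Act i j)
    then show ?thesis using step[of l] \<theta>(2)[OF Act] by simp
  next
    case Jump
    then show ?thesis using step[of l] F[OF Jump] unfolding Jump timed_step.simps step.simps E[OF Jump] by blast
  next
    case Tick
    then show ?thesis using step[of l] by simp
  qed
  then have run: "timed_run ?R \<theta> E r"
    using gca \<theta>(1) rf exe jumps by (intro timed_runI) (auto simp: execution_def)
  then interpret timed_run ?R \<theta> E r .
  have "env_step S (own_values ?R E (cfg r 0) m) (environments ?R E (cfg r 0) m) (E m)" for m
  proof -
    obtain l where l: "evt r l = Jump" "njumps r l = m" using ex_njumps[OF jumps] by blast
    then show ?thesis
      using F[OF l(1)] E[OF l(1)] own_values_at_jump[OF l(1)] environments_at_jump[of l] by simp
  qed
  then have "env_consistent S E (cfg r 0)" by (simp add: env_consistent_def)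
  with run show thesis by (rule that)
qed

lemma execution_timed_run:
  assumes gca: "gca_system S" and rf: "\<forall>\<theta>\<in>timings S. race_free (redundant S) \<theta>"
    and c: "c \<in> initial (redundant S)" and E: "env_consistent S E c"
  obtains \<theta> r where "timed_run (redundant S) \<theta> E r" "execution S r" "cfg r 0 = c"
proof -
  let ?R = "redundant S"
  obtain \<theta> where \<theta>: "\<theta> \<in> timings S" using gca by (auto simp: gca_system_def)
  have T: "0 < period S" and adm: "admissible_timing ?R (period S) \<theta>" and "program ?R \<noteq> []"
    and "\<And>i. i \<in> machines ?R \<Longrightarrow> nxt (c i) = None"
    using gca \<theta> c by (auto simp: gca_system_def)
  then obtain r :: "('a, 'b, 'c) run" where r: "cfg r 0 = c" "clk r 0 = 0"
    "\<And>l. timed_step ?R \<theta> E (njumps r l) (evt r l)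
      (cfg r l, clk r l) (cfg r (Suc l), clk r (Suc l))"
    "\<And>l. evt r l = Jump \<Longrightarrow> clk r l = real (njumps r l) * period S"
    "\<And>l. \<exists>l'\<ge>l. evt r l' = Jump"
    using scheduled_run[OF adm T] by metis
  have run: "timed_run ?R \<theta> E r"
    using gca \<theta> rf c r by (intro timed_runI) auto
  then interpret timed_run ?R \<theta> E r .
  have "step S (evt r l) (cfg r l, clk r l) (cfg r (Suc l), clk r (Suc l))" for l
  proof (cases "evt r l")
    case (Act i j)
    then show ?thesis using r(3)[of l] by simp
  next
    case Jump
    have "env_step S (\<lambda>x a. vars (cfg r l x) a x) (\<lambda>x. env (cfg r l x)) (E (njumps r l))"
      using E own_values_at_jump[OF Jump] environments_at_jump[of l]
      by (simp add: env_consistent_def r(1))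
    then show ?thesis using r(3)[of l] Jump by auto
  next
    case Tick
    then show ?thesis using r(3)[of l] by simp
  qed
  moreover have "\<exists>!l. evt r l = Jump \<and> clk r l = real m * period S" for m
  proof -
    obtain l where l: "evt r l = Jump" "njumps r l = m" using ex_njumps[OF jumps] by blast
    show ?thesis
    proof (rule ex1I[of _ l])
      show "evt r l = Jump \<and> clk r l = real m * period S" using l r(4) by simp
    next
      fix l'
      assume l': "evt r l' = Jump \<and> clk r l' = real m * period S"
      then have "njumps r l' = m" using r(4)[of l'] T by simp
      then show "l' = l" using l l' njumps_inj[of r l' l] by simp
    qed
  qed
  moreover have "clk r l = \<theta> (period_no r l) i j" if "evt r l = Act i j" for l i j
    using actD(6)[OF that] by (simp add: period_no_def njumps_def)
  ultimately have "execution S r"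
    unfolding execution_def r(1,2) using c r(4) \<theta> by blast
  with run show thesis using r(1) by (rule that)
qed

lemma models_transfer:
  assumes "gca_system S" "\<forall>\<theta>\<in>timings S. race_free (redundant S) \<theta>"
    and "gca_system S'" "\<forall>\<theta>\<in>timings S'. race_free (redundant S') \<theta>"
    and same: "same_components S S'" and nf: "next_free \<phi>"
    and i: "i \<in> machines (redundant S)"
    and loc: "\<forall>p\<in>atoms \<phi>. prop_vars p \<subseteq> local_vars (redundant S) i"
    and "models code S \<phi>"
  shows "models code S' \<phi>"
  unfolding models_def
proof (intro allI impI)
  fix r'
  assume r': "execution S' r'"
  have R: "redundant S' = redundant S" and "env_step S' = env_step S"
    using same by (simp_all add: same_components_def)
  then have consistent: "env_consistent S' = env_consistent S"
    by (intro ext) (simp add: env_consistent_def)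
  obtain \<theta>' E where run': "timed_run (redundant S) \<theta>' E r'" and E: "env_consistent S E (cfg r' 0)"
    using timed_run_execution[OF assms(3,4) r'] unfolding R consistent by blast
  have "cfg r' 0 \<in> initial (redundant S)" using r' by (simp add: execution_def R)
  then obtain \<theta> r where run: "timed_run (redundant S) \<theta> E r" and r: "execution S r" "cfg r 0 = cfg r' 0"
    using execution_timed_run[OF assms(1,2) _ E] by blast
  have "sat (prop_holds code) (cfg r) 0 \<phi>" using r(1) assms(9) by (simp add: models_def)
  then show "sat (prop_holds code) (cfg r') 0 \<phi>"
    using sat_view[OF run i nf loc] sat_view[OF run' i nf loc] r(2) by simp
qed

theorem theorem1:
  fixes S S_sync :: "('a, 'e, 'v :: {plus, times, divide, uminus}) gca"
    and \<phi> :: "('a, 'v) state_prop pltl"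
    and code :: "nat option \<Rightarrow> 'v"
  assumes "gca_system S"
    and "deterministic_assumption S"
    and "gca_system S_sync"
    and "same_components S S_sync"
    and "synchronous S_sync"
    and "next_free \<phi>"
    and "\<exists>i\<in>machines (redundant S). \<forall>p\<in>atoms \<phi>. prop_vars p \<subseteq> local_vars (redundant S) i"
  shows "models code S \<phi> \<longleftrightarrow> models code S_sync \<phi>"
proof -
  have rf: "\<forall>\<theta>\<in>timings S. race_free (redundant S) \<theta>"
    using assms(1,2) by (auto simp: gca_system_def intro: race_free_deterministic)
  have rf_sync: "\<forall>\<theta>\<in>timings S_sync. race_free (redundant S_sync) \<theta>"
    using assms(5) by (auto intro: race_free_synchronous)
  obtain i where i: "i \<in> machines (redundant S)"
    "\<forall>p\<in>atoms \<phi>. prop_vars p \<subseteq> local_vars (redundant S) i"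
    using assms(7) by blast
  have same: "same_components S_sync S" and R: "redundant S_sync = redundant S"
    using assms(4) by (simp_all add: same_components_def)
  show ?thesis
    using models_transfer[OF assms(1) rf assms(3) rf_sync assms(4,6) i]
      models_transfer[OF assms(3) rf_sync assms(1) rf same assms(6)] i
    unfolding R by blast
qed

end
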